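(* Let $(X,R,\beta)$ be a $\beta$-space that is Hausdorff, ordered, radially complete, level structured, and CDLB. Then any contraction $f:X\to X$ has a unique fixed point.
   Context: A $\beta$-space $(X,R,\beta)$ is a topological space $X$ together with a set $R$ (of radial values) and a function $\beta: X\times R\to\mathcal{P}(X)$ (the power set of $X$) such that: (1) $x\in\beta(x,r)$ for all $x\in X$, $r\in R$; (2) $\beta(x,r)$ is open for all $x\in X$, $r\in R$; (3) for any open set $U$ and any $z\in U$ there is a $t\in R$ with $\beta(z,t)\subseteq U$; (4) for any $r\in R$ there is an $s\in R$ such that for all $x,y\in X$, if $x\in\beta(y,s)$ then $\beta(y,s)\subseteq\beta(x,r)$. An $s$ as in (4) is called a swing value of $r$. A swing sequence for $r\in R$ is a sequence $(r_i)_{i=1}^\infty$ in $R$ with $r_1=r$ and $r_{k+1}$ a swing value of $r_k$ for each $k$. Ordered: define $r\le s$ on $R$ by $\beta(x,r)\subseteq\beta(x,s)$ for all $x\in X$; the space is ordered if $\le$ is a linear order on $R$. Level sets: $L(x,r)$ is the set of all $y\in X$ for which there exists a swing sequence $(r_i)$ for $r$ such that $y\in\beta(x,r_i)$ for all $i$. Radial values $r,s$ are level equivalent, $r=_L s$, if $L(x,r)=L(x,s)$ for all $x\in X$. Write $s\le_L r$ if $L(x,s)\subseteq L(x,r)$ for all $x\in X$ (on an ordered $\beta$-space this gives a linear order on $R/{=_L}$), and $s<_L r$ if $s\le_L r$ and not $s=_L r$. Completeness: a sequence $(a_i)$ in $X$ is Cauchy if for all $r\in R$ there is $N$ with $a_m\in\beta(a_n,r)$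 for all $n,m\ge N$; $X$ is complete if every Cauchy sequence in $X$ converges to a point of $X$. For $r\in R$, $(a_i)$ is $r$-Cauchy if there is a swing sequence $(r_i)$ for $r$ such that for all $n\in\mathbb{N}$ there is $M\in\mathbb{N}$ with $a_j\in\beta(a_k,r_n)$ for all $j,k\ge M$; $(a_i)$ $r$-converges to $x\in X$ if there is a swing sequence $(r_i)$ for $r$ such that for all $n\in\mathbb{N}$ there is $M\in\mathbb{N}$ with $a_m\in\beta(x,r_n)$ for all $m\ge M$. $X$ is $r$-complete if every $r$-Cauchy sequence $r$-converges to some point of $X$, and radially complete if it is complete and $r$-complete for all $r\in R$. Structured: for any $x\in X$ and any finite collection $y_1,\dots,y_n\in X$ there is $s\in R$ with $y_1,\dots,y_n\in\beta(x,s)$. Level structured: structured and, moreover, whenever $x\in X$, $r\in R$ and $y_1,\dots,y_n\in L(x,r)$ are such that some $y_k$ can be separated from $x$ by disjoint open neighborhoods, the $s\in R$ with $y_1,\dots,y_n\in\beta(x,s)$ can be chosen so that $s<_L r$. CDLB (countably and discretely level-based): every sequence $(r_i)_{i=1}^\infty$ in $R$ with $r_{i+1}<_L r_i$ for all $i$ is a countable level base, i.e. for all $s\in R$ there is a $k$ with $r_k\le_L s$. Contraction: a function $f:X\to X$ for which there is an integer $N\in\mathbb{N}$ such that (1) $f(\beta(x,r))\subseteq\beta(f(x),r)$ for all $x\in X$, $r\in R$; and (2) each $r\in R$ has a swing value $s$ such that $f^N(\beta(x,r))\subseteq\beta(f^N(x),s)$ for all $x\in X$. *)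

theory Defs
  imports "HOL-Analysis.Analysis"
begin

locale beta_space =
  fixes X :: "'a topology" and R :: "'r set" and \<beta> :: "'a \<Rightarrow> 'r \<Rightarrow> 'a set"
  assumes center_in: "\<And>x r. x \<in> topspace X \<Longrightarrow> r \<in> R \<Longrightarrow> x \<in> \<beta> x r"
    and openin_beta: "\<And>x r. x \<in> topspace X \<Longrightarrow> r \<in> R \<Longrightarrow> openin X (\<beta> x r)"
    and beta_base: "\<And>U z. openin X U \<Longrightarrow> z \<in> U \<Longrightarrow> \<exists>t\<in>R. \<beta> z t \<subseteq> U"
    and swing: "\<And>r. r \<in> R \<Longrightarrow>
      \<exists>s\<in>R. \<forall>x\<in>topspace X. \<forall>y\<in>topspace X. x \<in> \<beta> y s \<longrightarrow> \<beta> y s \<subseteq> \<beta> x r"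
begin

definition swing_value :: "'r \<Rightarrow> 'r \<Rightarrow> bool" where
  "swing_value s r \<longleftrightarrow> s \<in> R \<and>
     (\<forall>x\<in>topspace X. \<forall>y\<in>topspace X. x \<in> \<beta> y s \<longrightarrow> \<beta> y s \<subseteq> \<beta> x r)"

text \<open>Sequences are indexed from 0, so a swing sequence for \<open>r\<close> has \<open>\<rho> 0 = r\<close>.\<close>

definition swing_sequence :: "'r \<Rightarrow> (nat \<Rightarrow> 'r) \<Rightarrow> bool" where
  "swing_sequence r \<rho> \<longleftrightarrow> range \<rho> \<subseteq> R \<and> \<rho> 0 = r \<and> (\<forall>k. swing_value (\<rho> (Suc k)) (\<rho> k))"

definition radial_order :: "('r \<times> 'r) set" where
  "radial_order = {(r, s). r \<in> R \<and> s \<in> R \<and> (\<forall>x\<in>topspace X. \<beta> x r \<subseteq> \<beta> x s)}"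

definition ordered :: bool where
  "ordered \<longleftrightarrow> linear_order_on R radial_order"

definition level :: "'a \<Rightarrow> 'r \<Rightarrow> 'a set" where
  "level x r = {y \<in> topspace X. \<exists>\<rho>. swing_sequence r \<rho> \<and> (\<forall>i. y \<in> \<beta> x (\<rho> i))}"

definition level_equiv :: "'r \<Rightarrow> 'r \<Rightarrow> bool" where
  "level_equiv r s \<longleftrightarrow> (\<forall>x\<in>topspace X. level x r = level x s)"

definition level_le :: "'r \<Rightarrow> 'r \<Rightarrow> bool" where
  "level_le s r \<longleftrightarrow> (\<forall>x\<in>topspace X. level x s \<subseteq> level x r)"

definition level_less :: "'r \<Rightarrow> 'r \<Rightarrow> bool" where
  "level_less s r \<longleftrightarrow> level_le s r \<and> \<not> level_equiv s r"

definition beta_Cauchy :: "(nat \<Rightarrow> 'a) \<Rightarrow> bool" where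
  "beta_Cauchy a \<longleftrightarrow> (\<forall>r\<in>R. \<exists>N. \<forall>m\<ge>N. \<forall>n\<ge>N. a m \<in> \<beta> (a n) r)"

definition beta_complete :: bool where
  "beta_complete \<longleftrightarrow> (\<forall>a. range a \<subseteq> topspace X \<and> beta_Cauchy a \<longrightarrow>
     (\<exists>x\<in>topspace X. limitin X a x sequentially))"

definition r_Cauchy :: "'r \<Rightarrow> (nat \<Rightarrow> 'a) \<Rightarrow> bool" where
  "r_Cauchy r a \<longleftrightarrow> (\<exists>\<rho>. swing_sequence r \<rho> \<and>
     (\<forall>n. \<exists>M. \<forall>j\<ge>M. \<forall>k\<ge>M. a j \<in> \<beta> (a k) (\<rho> n)))"

definition r_converges :: "'r \<Rightarrow> (nat \<Rightarrow> 'a) \<Rightarrow> 'a \<Rightarrow> bool" where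
  "r_converges r a x \<longleftrightarrow> (\<exists>\<rho>. swing_sequence r \<rho> \<and>
     (\<forall>n. \<exists>M. \<forall>m\<ge>M. a m \<in> \<beta> x (\<rho> n)))"

definition r_complete :: "'r \<Rightarrow> bool" where
  "r_complete r \<longleftrightarrow> (\<forall>a. range a \<subseteq> topspace X \<and> r_Cauchy r a \<longrightarrow>
     (\<exists>x\<in>topspace X. r_converges r a x))"

definition radially_complete :: bool where
  "radially_complete \<longleftrightarrow> beta_complete \<and> (\<forall>r\<in>R. r_complete r)"

definition structured :: bool where
  "structured \<longleftrightarrow> (\<forall>x\<in>topspace X. \<forall>Y. finite Y \<and> Y \<subseteq> topspace X \<longrightarrow> (\<exists>s\<in>R. Y \<subseteq> \<beta> x s))"

definition separated_points :: "'a \<Rightarrow> 'a \<Rightarrow> bool" where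
  "separated_points x y \<longleftrightarrow>
     (\<exists>U V. openin X U \<and> openin X V \<and> x \<in> U \<and> y \<in> V \<and> disjnt U V)"

definition level_structured :: bool where
  "level_structured \<longleftrightarrow> structured \<and>
     (\<forall>x\<in>topspace X. \<forall>r\<in>R. \<forall>Y. finite Y \<and> Y \<subseteq> level x r \<and> (\<exists>y\<in>Y. separated_points x y) \<longrightarrow>
        (\<exists>s\<in>R. Y \<subseteq> \<beta> x s \<and> level_less s r))"

definition countable_level_base :: "(nat \<Rightarrow> 'r) \<Rightarrow> bool" where
  "countable_level_base \<rho> \<longleftrightarrow> (\<forall>s\<in>R. \<exists>k. level_le (\<rho> k) s)"

definition CDLB :: bool where
  "CDLB \<longleftrightarrow> (\<forall>\<rho>. range \<rho> \<subseteq> R \<and> (\<forall>i. level_less (\<rho> (Suc i)) (\<rho> i)) \<longrightarrow>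
     countable_level_base \<rho>)"

definition contraction :: "('a \<Rightarrow> 'a) \<Rightarrow> bool" where
  "contraction f \<longleftrightarrow> f \<in> topspace X \<rightarrow> topspace X \<and>
     (\<exists>N\<ge>1.
        (\<forall>x\<in>topspace X. \<forall>r\<in>R. f ` \<beta> x r \<subseteq> \<beta> (f x) r) \<and>
        (\<forall>r\<in>R. \<exists>s. swing_value s r \<and>
           (\<forall>x\<in>topspace X. (f ^^ N) ` \<beta> x r \<subseteq> \<beta> ((f ^^ N) x) s)))"

end

end

theory Submission
  imports Defs
begin

text \<open>
  Replacing \<open>f\<close> by \<open>f ^^ N\<close>, one may assume that \<open>f\<close> carries \<open>\<beta> x r\<close> into \<open>\<beta> (f x) s\<close> for a swing
  value \<open>s\<close> of \<open>r\<close>. If \<open>f x \<in> \<beta> x r\<close>, the orbit of \<open>x\<close> is then \<open>r\<close>-Cauchy, and its \<open>r\<close>-limit \<open>y\<close>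
  satisfies \<open>f y \<in> L(y,r)\<close>. If \<open>y\<close> is not fixed, level structuredness yields some \<open>s <\<^sub>L r\<close> with
  \<open>f y \<in> \<beta> y s\<close>, and one starts again from \<open>y\<close> and \<open>s\<close>. Unless a fixed point turns up, this produces
  a strictly descending sequence of levels, which by CDLB is a level base, together with points
  \<open>y\<^sub>i\<close> each of whose successors lies in \<open>L(y\<^sub>i,r\<^sub>i)\<close>. Hence \<open>(y\<^sub>i)\<close> is Cauchy, and its limit is
  fixed. Two distinct fixed points would, by the same descent, lie in a common level for every
  radial value, contradicting the Hausdorff property.
\<close>

context beta_space
begin

section \<open>Calculus of swing values and swing sequences\<close>

lemma swing_valueD:
  "swing_value s r \<Longrightarrow> x \<in> topspace X \<Longrightarrow> y \<in> topspace X \<Longrightarrow> x \<in> \<beta> y s \<Longrightarrow> \<beta> y s \<subseteq> \<beta> x r"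
  unfolding swing_value_def by blast

lemma swing_value_in: "swing_value s r \<Longrightarrow> s \<in> R"
  unfolding swing_value_def by blast

lemma swing_value_subset: "swing_value s r \<Longrightarrow> x \<in> topspace X \<Longrightarrow> \<beta> x s \<subseteq> \<beta> x r"
  using swing_valueD swing_value_in center_in by blast

text \<open>An \<open>s\<close>-ball lies in the \<open>r\<close>-ball about each of its points and
  contains its own centre. Reversing a relation thus costs one swing step.\<close>

lemma swing_value_sym:
  assumes "swing_value s r" "x \<in> topspace X" "y \<in> topspace X" "y \<in> \<beta> x s"
  shows "x \<in> \<beta> y r"
  using swing_valueD[OF assms(1,3,2,4)] center_in assms(2) swing_value_in[OF assms(1)] by blast

lemma swing_value_common:
  assumes "swing_value s r" "x \<in> topspace X" "y \<in> topspace X" "z \<in> topspace X"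
    "x \<in> \<beta> z s" "y \<in> \<beta> z s"
  shows "y \<in> \<beta> x r"
  using swing_valueD[OF assms(1,2,4,5)] assms(6) by blast

lemma swing_value_trans:
  assumes "swing_value s r" "swing_value t s" "x \<in> topspace X" "y \<in> topspace X"
    "y \<in> \<beta> x t" "z \<in> \<beta> y s"
  shows "z \<in> \<beta> x r"
  using swing_value_sym[OF assms(2-5)] swing_valueD[OF assms(1) assms(3,4)] assms(6) by blast

lemma exists_swing_value: "r \<in> R \<Longrightarrow> \<exists>s. swing_value s r"
  using swing unfolding swing_value_def by blast

lemma swing_sequence_in: "swing_sequence r \<rho> \<Longrightarrow> \<rho> i \<in> R"
  unfolding swing_sequence_def by blast

lemma swing_sequence_0: "swing_sequence r \<rho> \<Longrightarrow> \<rho> 0 = r"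
  unfolding swing_sequence_def by blast

lemma swing_sequence_Suc: "swing_sequence r \<rho> \<Longrightarrow> swing_value (\<rho> (Suc i)) (\<rho> i)"
  unfolding swing_sequence_def by blast

lemma level_subset_topspace: "level x r \<subseteq> topspace X"
  unfolding level_def by blast

lemma level_subset_beta: "level x r \<subseteq> \<beta> x r"
  unfolding level_def swing_sequence_def by blast

lemma level_less_level_le: "level_less s r \<Longrightarrow> level_le s r"
  unfolding level_less_def by blast

lemma level_leD: "level_le s r \<Longrightarrow> x \<in> topspace X \<Longrightarrow> level x s \<subseteq> level x r"
  unfolding level_le_def by blast

lemma center_in_level:
  assumes "x \<in> topspace X" "r \<in> R"
  shows "x \<in> level x r"
proof -
  \<comment> \<open>\<open>dependent_nat_choice\<close> does not prescribe the first term; the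
    conjunct guarded by \<open>n = 0\<close> pins it to \<open>r\<close>.\<close>
  have "\<exists>\<rho>. \<forall>n. (\<rho> n \<in> R \<and> (n = 0 \<longrightarrow> \<rho> n = r)) \<and> swing_value (\<rho> (Suc n)) (\<rho> n)"
    using assms(2) exists_swing_value swing_value_in by (intro dependent_nat_choice) blast+
  then obtain \<rho> where "swing_sequence r \<rho>"
    unfolding swing_sequence_def by blast
  then show ?thesis
    unfolding level_def using assms(1) center_in swing_sequence_in by blast
qed

section \<open>Linear order of radial values and the laws of levels\<close>

text \<open>The larger radial value is taken termwise. At \<open>Suc i\<close> it belongs to one of
  the two sequences, so its ball lies in that sequence's ball at \<open>i\<close>, hence in the
  larger one. Memberships with different witnesses can thus be put on one sequence.\<close>

lemma swing_sequence_sup: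
  assumes ord: ordered and \<rho>: "swing_sequence r \<rho>" and \<sigma>: "swing_sequence s \<sigma>"
    and sr: "(s, r) \<in> radial_order"
  obtains \<tau> where "swing_sequence r \<tau>"
    "\<And>i x. x \<in> topspace X \<Longrightarrow> \<beta> x (\<rho> i) \<subseteq> \<beta> x (\<tau> i) \<and> \<beta> x (\<sigma> i) \<subseteq> \<beta> x (\<tau> i)"
proof
  have tot: "total_on R radial_order" and anti: "antisym radial_order"
    using ord unfolding ordered_def linear_order_on_def partial_order_on_def by auto
  define \<tau> where "\<tau> i = (if (\<rho> i, \<sigma> i) \<in> radial_order then \<sigma> i else \<rho> i)" for i
  have R: "\<rho> i \<in> R" "\<sigma> i \<in> R" for i
    using \<rho> \<sigma> swing_sequence_in by blast+
  show sub: "\<beta> x (\<rho> i) \<subseteq> \<beta> x (\<tau> i) \<and> \<beta> x (\<sigma> i) \<subseteq> \<beta> x (\<tau> i)" if "x \<in> topspace X" for i x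
  proof (cases "(\<rho> i, \<sigma> i) \<in> radial_order")
    case True
    then show ?thesis using that unfolding \<tau>_def radial_order_def by auto
  next
    case False
    then have "\<rho> i = \<sigma> i \<or> (\<sigma> i, \<rho> i) \<in> radial_order"
      using tot R unfolding total_on_def by blast
    then show ?thesis using that False unfolding \<tau>_def radial_order_def by auto
  qed
  have "swing_value (\<tau> (Suc i)) (\<tau> i)" for i
    unfolding swing_value_def
  proof (intro conjI ballI impI)
    show "\<tau> (Suc i) \<in> R" using R by (simp add: \<tau>_def)
    fix x y assume xy: "x \<in> topspace X" "y \<in> topspace X" "x \<in> \<beta> y (\<tau> (Suc i))"
    have "\<tau> (Suc i) = \<rho> (Suc i) \<or> \<tau> (Suc i) = \<sigma> (Suc i)"
      by (simp add: \<tau>_def)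
    then show "\<beta> y (\<tau> (Suc i)) \<subseteq> \<beta> x (\<tau> i)"
      using swing_valueD[OF swing_sequence_Suc[OF \<rho>] xy(1,2), of i]
        swing_valueD[OF swing_sequence_Suc[OF \<sigma>] xy(1,2), of i] sub[OF xy(1), of i] xy(3)
      by (metis subset_trans)
  qed
  \<comment> \<open>If the definition selects \<open>s\<close> here, then \<open>r\<close> and
    \<open>s\<close> precede each other and antisymmetry gives \<open>s = r\<close>.\<close>
  moreover have "\<tau> 0 = r"
    using sr anti swing_sequence_0[OF \<rho>] swing_sequence_0[OF \<sigma>]
    unfolding \<tau>_def by (auto dest: antisymD)
  ultimately show "swing_sequence r \<tau>"
    unfolding swing_sequence_def using R by (auto simp: \<tau>_def)
qed

lemma radial_order_refl: "r \<in> R \<Longrightarrow> (r, r) \<in> radial_order"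
  unfolding radial_order_def by blast

text \<open>The same sequence is a witness: membership at index \<open>Suc i\<close> reverses to
  membership at \<open>i\<close>.\<close>

lemma level_sym:
  assumes "x \<in> topspace X" "y \<in> level x r"
  shows "x \<in> level y r"
proof -
  obtain \<rho> where \<rho>: "swing_sequence r \<rho>" "\<And>i. y \<in> \<beta> x (\<rho> i)"
    using assms(2) unfolding level_def by blast
  have "x \<in> \<beta> y (\<rho> i)" for i
    using swing_value_sym[OF swing_sequence_Suc[OF \<rho>(1)] assms(1)] \<rho>(2) assms(2)
      level_subset_topspace by blast
  then show ?thesis
    unfolding level_def using assms(1) \<rho>(1) by blast
qed

text \<open>The supremum of the two witnessing sequences serves both memberships. Composing them
  loses at most two indices, which is harmless because they hold at every index.\<close>

lemma level_trans_mono: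
  assumes ord: ordered and x: "x \<in> topspace X" and y: "y \<in> level x r" and z: "z \<in> level y s"
    and sr: "(s, r) \<in> radial_order"
  shows "z \<in> level x r"
proof -
  obtain \<rho> where \<rho>: "swing_sequence r \<rho>" "\<And>i. y \<in> \<beta> x (\<rho> i)"
    using y unfolding level_def by blast
  obtain \<sigma> where \<sigma>: "swing_sequence s \<sigma>" "\<And>i. z \<in> \<beta> y (\<sigma> i)"
    using z unfolding level_def by blast
  obtain \<tau> where \<tau>: "swing_sequence r \<tau>"
    "\<And>i x. x \<in> topspace X \<Longrightarrow> \<beta> x (\<rho> i) \<subseteq> \<beta> x (\<tau> i) \<and> \<beta> x (\<sigma> i) \<subseteq> \<beta> x (\<tau> i)"
    using swing_sequence_sup[OF ord \<rho>(1) \<sigma>(1) sr] by metis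
  have yt: "y \<in> topspace X" and zt: "z \<in> topspace X"
    using y z level_subset_topspace by blast+
  have "z \<in> \<beta> x (\<tau> i)" for i
    using swing_value_trans[OF swing_sequence_Suc[OF \<tau>(1)] swing_sequence_Suc[OF \<tau>(1)] x yt]
      \<tau>(2) x yt \<rho>(2) \<sigma>(2) by blast
  then show ?thesis
    unfolding level_def using zt \<tau>(1) by blast
qed

lemma level_trans:
  assumes "ordered" "x \<in> topspace X" "r \<in> R" "y \<in> level x r" "z \<in> level y r"
  shows "z \<in> level x r"
  using assms level_trans_mono radial_order_refl by blast

lemma level_mono:
  assumes "ordered" "(s, r) \<in> radial_order" "x \<in> topspace X"
  shows "level x s \<subseteq> level x r"
  using level_trans_mono[OF assms(1,3)] center_in_level assms(2,3) unfolding radial_order_def by blast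

text \<open>Level structuredness compares levels, while \<open>swing_sequence_sup\<close> needs
  radial values compared. The opposite radial comparison would, by \<open>level_mono\<close>, make
  the two level equivalent.\<close>

lemma level_less_radial_order:
  assumes ord: ordered and "r \<in> R" "s \<in> R" "level_less s r"
  shows "(s, r) \<in> radial_order"
proof (rule ccontr)
  assume "(s, r) \<notin> radial_order"
  moreover have "total_on R radial_order"
    using ord unfolding ordered_def linear_order_on_def by blast
  ultimately have "(r, s) \<in> radial_order"
    using assms(2,3) radial_order_refl[OF assms(2)] unfolding total_on_def by metis
  then have "level_le r s"
    unfolding level_le_def using level_mono[OF ord] by simp
  then show False
    using assms(4) unfolding level_less_def level_le_def level_equiv_def by blast
qed

section \<open>Separation of points and descent in the level order\<close>

lemma Hausdorff_separated_points:
  assumes "Hausdorff_space X" "x \<in> topspace X" "y \<in> topspace X" "x \<noteq> y"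
  shows "separated_points x y"
  using assms unfolding Hausdorff_space_def separated_points_def by blast

lemma Hausdorff_eqI:
  assumes "Hausdorff_space X" "x \<in> topspace X" "y \<in> topspace X" "\<And>s. s \<in> R \<Longrightarrow> y \<in> \<beta> x s"
  shows "x = y"
proof (rule ccontr)
  assume "x \<noteq> y"
  then obtain U V where "openin X U" "x \<in> U" "y \<in> V" "disjnt U V"
    using Hausdorff_separated_points[OF assms(1-3)] unfolding separated_points_def by blast
  then show False
    using beta_base[of U x] assms(4) unfolding disjnt_def by blast
qed

lemma level_structured_descend:
  assumes "Hausdorff_space X" "level_structured" "x \<in> topspace X" "r \<in> R" "y \<in> level x r" "x \<noteq> y"
  obtains s where "s \<in> R" "y \<in> \<beta> x s" "level_less s r"
proof -
  have "separated_points x y"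
    using Hausdorff_separated_points assms level_subset_topspace by blast
  then have "\<exists>s\<in>R. {y} \<subseteq> \<beta> x s \<and> level_less s r"
    using assms(2-5) unfolding level_structured_def by blast
  then show ?thesis using that by blast
qed

section \<open>Maps that shrink balls at the first iterate\<close>

definition strict_contraction :: "('a \<Rightarrow> 'a) \<Rightarrow> bool" where
  "strict_contraction g \<longleftrightarrow> g \<in> topspace X \<rightarrow> topspace X \<and>
     (\<forall>r\<in>R. \<exists>s. swing_value s r \<and> (\<forall>x\<in>topspace X. g ` \<beta> x r \<subseteq> \<beta> (g x) s))"

lemma strict_contraction_in:
  "strict_contraction g \<Longrightarrow> x \<in> topspace X \<Longrightarrow> g x \<in> topspace X"
  unfolding strict_contraction_def by blast

lemma strict_contraction_funpow_in:
  "strict_contraction g \<Longrightarrow> x \<in> topspace X \<Longrightarrow> (g ^^ k) x \<in> topspace X"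
  by (induction k) (auto intro: strict_contraction_in)

text \<open>The balls of a swing value of \<open>r\<close> lie in the \<open>r\<close>-balls with
  the same centre.\<close>

lemma strict_contraction_nonexpansive:
  assumes "strict_contraction g" "r \<in> R" "x \<in> topspace X" "y \<in> \<beta> x r"
  shows "g y \<in> \<beta> (g x) r"
proof -
  obtain s where s: "swing_value s r" "\<forall>x\<in>topspace X. g ` \<beta> x r \<subseteq> \<beta> (g x) s"
    using assms(1,2) unfolding strict_contraction_def by metis
  have "g y \<in> \<beta> (g x) s"
    using s(2) assms(3,4) by blast
  then show ?thesis
    using swing_value_subset[OF s(1) strict_contraction_in[OF assms(1,3)]] by blast
qed

lemma contraction_strict_funpow:
  assumes "contraction f"
  obtains N where "strict_contraction (f ^^ N)"
proof -
  obtain N where f: "f \<in> topspace X \<rightarrow> topspace X" and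
    N: "\<forall>r\<in>R. \<exists>s. swing_value s r \<and> (\<forall>x\<in>topspace X. (f ^^ N) ` \<beta> x r \<subseteq> \<beta> ((f ^^ N) x) s)"
    using assms unfolding contraction_def by metis
  have "(f ^^ N) x \<in> topspace X" if "x \<in> topspace X" for x
    using that f by (induction N) auto
  then show ?thesis
    using that N unfolding strict_contraction_def by blast
qed

section \<open>Orbits and their radial limits\<close>

text \<open>The swing value in the shrinking condition depends on the radial value only, so one
  sequence of successive choices serves all pairs of points.\<close>

lemma strict_contraction_swing_sequence:
  assumes g: "strict_contraction g" and "r \<in> R"
  obtains \<rho> where "swing_sequence r \<rho>"
    "\<And>x y k. x \<in> topspace X \<Longrightarrow> y \<in> \<beta> x r \<Longrightarrow> (g ^^ k) y \<in> \<beta> ((g ^^ k) x) (\<rho> k)"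
proof -
  have "\<exists>\<rho>. \<forall>n. (\<rho> n \<in> R \<and> (n = 0 \<longrightarrow> \<rho> n = r)) \<and>
      (swing_value (\<rho> (Suc n)) (\<rho> n) \<and> (\<forall>x\<in>topspace X. g ` \<beta> x (\<rho> n) \<subseteq> \<beta> (g x) (\<rho> (Suc n))))"
  proof (rule dependent_nat_choice)
    show "\<exists>s. s \<in> R \<and> (0 = 0 \<longrightarrow> s = r)"
      using \<open>r \<in> R\<close> by blast
    show "\<exists>t. (t \<in> R \<and> (Suc n = 0 \<longrightarrow> t = r)) \<and>
        (swing_value t s \<and> (\<forall>x\<in>topspace X. g ` \<beta> x s \<subseteq> \<beta> (g x) t))"
      if "s \<in> R \<and> (n = 0 \<longrightarrow> s = r)" for s n
      using that g swing_value_in unfolding strict_contraction_def by blast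
  qed
  then obtain \<rho> where \<rho>: "\<And>n. \<rho> n \<in> R" "\<rho> 0 = r" "\<And>n. swing_value (\<rho> (Suc n)) (\<rho> n)"
    "\<And>n x. x \<in> topspace X \<Longrightarrow> g ` \<beta> x (\<rho> n) \<subseteq> \<beta> (g x) (\<rho> (Suc n))"
    by (elim exE) metis
  have "(g ^^ k) y \<in> \<beta> ((g ^^ k) x) (\<rho> k)" if "x \<in> topspace X" "y \<in> \<beta> x r" for x y k
  proof (induction k)
    case 0
    then show ?case using that \<rho>(2) by simp
  next
    case (Suc k)
    then show ?case
      using \<rho>(4)[of "(g ^^ k) x" k] strict_contraction_funpow_in[OF g that(1)] by auto
  qed
  moreover have "swing_sequence r \<rho>"
    unfolding swing_sequence_def using \<rho> by blast
  ultimately show ?thesis using that by metis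
qed

text \<open>
  Different members of a level may be witnessed by different swing sequences; \<open>r_limit_in_level\<close>
  needs a single one serving the whole orbit.
\<close>

lemma strict_contraction_orbit:
  assumes g: "strict_contraction g" and x: "x \<in> topspace X" and \<rho>: "swing_sequence r \<rho>"
    and gx: "\<And>i. g x \<in> \<beta> x (\<rho> i)"
  shows "(g ^^ k) x \<in> \<beta> x (\<rho> i)"
proof (induction k arbitrary: i)
  case 0
  then show ?case using center_in[OF x swing_sequence_in[OF \<rho>]] by simp
next
  case (Suc k)
  note sw = swing_sequence_Suc[OF \<rho>] and gxt = strict_contraction_in[OF g x]
  have "g ((g ^^ k) x) \<in> \<beta> (g x) (\<rho> (Suc i))"
    using strict_contraction_nonexpansive[OF g swing_sequence_in[OF \<rho>] x Suc] .
  then have "g ((g ^^ k) x) \<in> \<beta> x (\<rho> i)"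
    using swing_value_common[OF sw x strict_contraction_funpow_in[OF g x, of "Suc k"] gxt]
      swing_value_sym[OF sw x gxt gx] by simp
  then show ?case by simp
qed

text \<open>Analogue of summing a geometric series: consecutive points get closer along
  \<open>\<rho>\<close>, and each swing step absorbs one composition, so errors do not
  accumulate.\<close>

lemma strict_contraction_r_Cauchy:
  assumes g: "strict_contraction g" and x: "x \<in> topspace X" and r: "r \<in> R" and gx: "g x \<in> \<beta> x r"
  shows "r_Cauchy r (\<lambda>k. (g ^^ k) x)"
proof -
  obtain \<rho> where \<rho>: "swing_sequence r \<rho>"
    "\<And>x y k. x \<in> topspace X \<Longrightarrow> y \<in> \<beta> x r \<Longrightarrow> (g ^^ k) y \<in> \<beta> ((g ^^ k) x) (\<rho> k)"
    using strict_contraction_swing_sequence[OF g r] by metis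
  define y where "y k = (g ^^ k) x" for k
  have sw: "swing_value (\<rho> (Suc i)) (\<rho> i)" for i
    using swing_sequence_Suc[OF \<rho>(1)] .
  have yt: "y k \<in> topspace X" for k
    unfolding y_def using strict_contraction_funpow_in[OF g x] .
  have step: "y (Suc k) \<in> \<beta> (y k) (\<rho> k)" for k
    using \<rho>(2)[OF x gx, of k] unfolding y_def by (simp add: funpow_swap1)
  \<comment> \<open>The hypothesis is used at \<open>Suc k\<close>, about the next orbit point and
    with a finer ball. The offset 2 pays for two swing steps: reversing the step from
    \<open>y (k + 2)\<close> to \<open>y (k + 3)\<close>, and joining the result to the
    tail.\<close>
  have tail: "y (k + 2 + d) \<in> \<beta> (y (k + 2)) (\<rho> k)" for k d
  proof (induction d arbitrary: k)
    case 0
    then show ?case using center_in[OF yt swing_sequence_in[OF \<rho>(1)]] by simp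
  next
    case (Suc d)
    have "y (k + 2) \<in> \<beta> (y (k + 3)) (\<rho> (Suc k))"
      using swing_value_sym[OF sw[of "Suc k"] yt yt] step[of "k + 2"]
      by (simp add: eval_nat_numeral)
    moreover have "y (k + 2 + Suc d) \<in> \<beta> (y (k + 3)) (\<rho> (Suc k))"
      using Suc[of "Suc k"] by (simp add: eval_nat_numeral)
    ultimately show ?case
      using swing_value_common[OF sw yt yt yt] by blast
  qed
  have "y i \<in> \<beta> (y j) (\<rho> n)" if "i \<ge> n + 3" "j \<ge> n + 3" for n i j
  proof -
    have "y m \<in> \<beta> (y (n + 3)) (\<rho> (Suc n))" if "m \<ge> n + 3" for m
    proof -
      have "Suc n + 2 + (m - (n + 3)) = m" "Suc n + 2 = n + 3"
        using that by simp_all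
      then show ?thesis
        using tail[of "Suc n" "m - (n + 3)"] by metis
    qed
    then have "y i \<in> \<beta> (y (n + 3)) (\<rho> (Suc n))" "y j \<in> \<beta> (y (n + 3)) (\<rho> (Suc n))"
      using that by blast+
    then show ?thesis
      using swing_value_common[OF sw yt yt yt] by blast
  qed
  then show ?thesis
    unfolding r_Cauchy_def y_def[symmetric] using \<rho>(1) by blast
qed

text \<open>A late orbit point is near \<open>y\<close> by convergence, and near \<open>g y\<close>
  as the image of its predecessor. Two spare indices allow reversing both relations and joining
  them.\<close>

lemma strict_contraction_r_limit:
  assumes g: "strict_contraction g" and x: "x \<in> topspace X" and y: "y \<in> topspace X"
    and lim: "r_converges r (\<lambda>k. (g ^^ k) x) y"
  shows "g y \<in> level y r"
proof -
  obtain \<rho> where \<rho>: "swing_sequence r \<rho>" "\<And>n. \<exists>M. \<forall>m\<ge>M. (g ^^ m) x \<in> \<beta> y (\<rho> n)"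
    using lim unfolding r_converges_def by blast
  have sw: "swing_value (\<rho> (Suc i)) (\<rho> i)" for i
    using swing_sequence_Suc[OF \<rho>(1)] .
  have gy: "g y \<in> topspace X"
    using strict_contraction_in[OF g y] .
  have "g y \<in> \<beta> y (\<rho> i)" for i
  proof -
    obtain M where M: "\<forall>m\<ge>M. (g ^^ m) x \<in> \<beta> y (\<rho> (Suc (Suc i)))"
      using \<rho>(2) by blast
    let ?z = "(g ^^ Suc M) x"
    have z: "?z \<in> topspace X"
      using strict_contraction_funpow_in[OF g x] .
    have "?z \<in> \<beta> y (\<rho> (Suc (Suc i)))"
      using M le_SucI order_refl by blast
    moreover have "?z \<in> \<beta> (g y) (\<rho> (Suc (Suc i)))"
      using strict_contraction_nonexpansive[OF g swing_sequence_in[OF \<rho>(1)] y, of "(g ^^ M) x"] M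
      by simp
    ultimately show ?thesis
      using swing_value_common[OF sw y gy z] swing_value_sym[OF sw y z] swing_value_sym[OF sw gy z]
      by blast
  qed
  then show ?thesis
    unfolding level_def using gy \<rho>(1) by blast
qed

text \<open>At each index a different \<open>a m\<close> links \<open>x\<close> to \<open>y\<close>,
  so all of them must lie in the balls of the one sequence \<open>\<rho>\<close>. Its supremum with
  the sequence of the convergence is the witness.\<close>

lemma r_limit_in_level:
  assumes ord: ordered and x: "x \<in> topspace X" and y: "y \<in> topspace X"
    and sr: "(s, r) \<in> radial_order" and lim: "r_converges s a y" and at: "\<And>k. a k \<in> topspace X"
    and \<rho>: "swing_sequence r \<rho>" and a: "\<And>k i. a k \<in> \<beta> x (\<rho> i)"
  shows "y \<in> level x r"
proof -
  obtain \<sigma> where \<sigma>: "swing_sequence s \<sigma>" "\<And>n. \<exists>M. \<forall>m\<ge>M. a m \<in> \<beta> y (\<sigma> n)"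
    using lim unfolding r_converges_def by blast
  obtain \<tau> where \<tau>: "swing_sequence r \<tau>"
    "\<And>i x. x \<in> topspace X \<Longrightarrow> \<beta> x (\<rho> i) \<subseteq> \<beta> x (\<tau> i) \<and> \<beta> x (\<sigma> i) \<subseteq> \<beta> x (\<tau> i)"
    using swing_sequence_sup[OF ord \<rho> \<sigma>(1) sr] by metis
  note sw = swing_sequence_Suc[OF \<tau>(1)]
  have "y \<in> \<beta> x (\<tau> i)" for i
  proof -
    obtain m where "a m \<in> \<beta> y (\<sigma> (Suc (Suc i)))"
      using \<sigma>(2) by blast
    then have "y \<in> \<beta> (a m) (\<tau> (Suc i))"
      using swing_value_sym[OF sw y at] \<tau>(2)[OF y] by blast
    moreover have "a m \<in> \<beta> x (\<tau> (Suc (Suc i)))"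
      using a \<tau>(2)[OF x] by blast
    ultimately show ?thesis
      using swing_value_trans[OF sw sw x at] by blast
  qed
  then show ?thesis
    unfolding level_def using y \<tau>(1) by blast
qed

lemma strict_contraction_orbit_limit:
  assumes "radially_complete" and g: "strict_contraction g" and x: "x \<in> topspace X" and r: "r \<in> R"
    and "g x \<in> \<beta> x r"
  obtains y where "y \<in> topspace X" "g y \<in> level y r" "r_converges r (\<lambda>k. (g ^^ k) x) y"
proof -
  have "range (\<lambda>k. (g ^^ k) x) \<subseteq> topspace X"
    using strict_contraction_funpow_in[OF g x] by blast
  then obtain y where "y \<in> topspace X" "r_converges r (\<lambda>k. (g ^^ k) x) y"
    using assms strict_contraction_r_Cauchy unfolding radially_complete_def r_complete_def by blast
  then show ?thesis
    using that strict_contraction_r_limit[OF g x] by blast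
qed

text \<open>One round of the descent. That \<open>y\<close> stays in the old level of
  \<open>x\<close> is what later makes the successive points a Cauchy sequence.\<close>

lemma strict_contraction_descend:
  assumes "Hausdorff_space X" and ord: ordered and "radially_complete" "level_structured"
    and g: "strict_contraction g" and x: "x \<in> topspace X" and r: "r \<in> R"
    and gx: "g x \<in> level x r" and ne: "g x \<noteq> x"
  obtains y s where "y \<in> topspace X" "s \<in> R" "g y \<in> level y s" "level_less s r" "y \<in> level x r"
proof -
  obtain s where s: "s \<in> R" "g x \<in> \<beta> x s" "level_less s r"
    using level_structured_descend[OF assms(1,4) x r gx] ne by metis
  obtain y where y: "y \<in> topspace X" "g y \<in> level y s" "r_converges s (\<lambda>k. (g ^^ k) x) y"
    using strict_contraction_orbit_limit[OF assms(3) g x s(1,2)] .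
  obtain \<rho> where \<rho>: "swing_sequence r \<rho>" "\<And>i. g x \<in> \<beta> x (\<rho> i)"
    using gx unfolding level_def by blast
  have "y \<in> level x r"
    using r_limit_in_level[OF ord x y(1) level_less_radial_order[OF ord r s(1,3)] y(3)
        strict_contraction_funpow_in[OF g x] \<rho>(1) strict_contraction_orbit[OF g x \<rho>]] .
  then show ?thesis
    using that s y by blast
qed

section \<open>Existence of a fixed point\<close>

lemma CDLB_base:
  assumes "CDLB" "\<And>i. \<rho> i \<in> R" "\<And>i. level_less (\<rho> (Suc i)) (\<rho> i)" "s \<in> R"
  shows "\<exists>k. level_le (\<rho> k) s"
proof -
  have "range \<rho> \<subseteq> R \<and> (\<forall>i. level_less (\<rho> (Suc i)) (\<rho> i))"
    using assms(2,3) by blast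
  then have "countable_level_base \<rho>"
    using assms(1)[unfolded CDLB_def, THEN spec[of _ \<rho>]] by (rule rev_mp)
  then show ?thesis
    using assms(4) unfolding countable_level_base_def by (rule bspec)
qed

lemma structured_pair:
  assumes "level_structured" "x \<in> topspace X" "y \<in> topspace X"
  obtains r where "r \<in> R" "y \<in> \<beta> x r"
proof -
  have "\<exists>r\<in>R. {y} \<subseteq> \<beta> x r"
    using assms unfolding level_structured_def structured_def by blast
  then show ?thesis using that by blast
qed

text \<open>The points \<open>g y\<close> and \<open>y\<close> are linked through
  \<open>g (a i)\<close> and \<open>a i\<close>; three successive swing values absorb the
  composition of these relations.\<close>

lemma strict_contraction_limit_fixed:
  assumes Haus: "Hausdorff_space X" and g: "strict_contraction g"
    and a: "\<And>i. a i \<in> topspace X" and y: "y \<in> topspace X" and lim: "limitin X a y sequentially"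
    and small: "\<And>s. s \<in> R \<Longrightarrow> \<forall>\<^sub>F i in sequentially. g (a i) \<in> \<beta> (a i) s"
  shows "g y = y"
proof (rule Hausdorff_eqI[OF Haus strict_contraction_in[OF g y] y])
  fix r assume r: "r \<in> R"
  obtain s where s: "swing_value s r" using exists_swing_value[OF r] by blast
  obtain t where t: "swing_value t s" using exists_swing_value[OF swing_value_in[OF s]] by blast
  obtain u where u: "swing_value u t" using exists_swing_value[OF swing_value_in[OF t]] by blast
  have uR: "u \<in> R" and tR: "t \<in> R"
    using u t swing_value_in by blast+
  have "\<forall>\<^sub>F i in sequentially. a i \<in> \<beta> y u"
    using lim openin_beta[OF y uR] center_in[OF y uR] unfolding limitin_def by blast
  with small[OF tR] have "\<forall>\<^sub>F i in sequentially. a i \<in> \<beta> y u \<and> g (a i) \<in> \<beta> (a i) t"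
    by eventually_elim blast
  then obtain i where i: "a i \<in> \<beta> y u" "g (a i) \<in> \<beta> (a i) t"
    using eventually_happens trivial_limit_sequentially by blast
  have gy: "g y \<in> topspace X" and ga: "g (a i) \<in> topspace X"
    using strict_contraction_in[OF g] y a by blast+
  have "g (a i) \<in> \<beta> (g y) u"
    using strict_contraction_nonexpansive[OF g uR y i(1)] .
  then have "g (a i) \<in> \<beta> (g y) t"
    using swing_value_subset[OF u gy] by blast
  moreover have "y \<in> \<beta> (g (a i)) s"
    using swing_value_common[OF t ga y a i(2) swing_value_sym[OF u y a i(1)]] .
  ultimately show "y \<in> \<beta> (g y) r"
    using swing_value_trans[OF s t gy ga] by blast
qed

lemma strict_contraction_exists_fixed:
  assumes "topspace X \<noteq> {}" and Haus: "Hausdorff_space X" and ord: ordered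
    and rc: "radially_complete" and ls: "level_structured" and "CDLB"
    and g: "strict_contraction g"
  shows "\<exists>x\<in>topspace X. g x = x"
proof (rule ccontr)
  assume "\<not> ?thesis"
  then have ne: "\<And>x. x \<in> topspace X \<Longrightarrow> g x \<noteq> x" by blast
  \<comment> \<open>States of the descent are pairs of a point and a radial value: CDLB concerns the
    second components, completeness the first.\<close>
  define P where "P p \<longleftrightarrow> (case p of (x, r) \<Rightarrow> x \<in> topspace X \<and> r \<in> R \<and> g x \<in> level x r)" for p
  define Q where "Q p q \<longleftrightarrow>
    (case p of (x, r) \<Rightarrow> case q of (y, s) \<Rightarrow> level_less s r \<and> y \<in> level x r)" for p q
  have "\<exists>h. \<forall>n. P (h n) \<and> Q (h n) (h (Suc n))"
  proof (rule dependent_nat_choice)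
    \<comment> \<open>Structuredness only puts \<open>g x\<close> into a ball about
      \<open>x\<close>; passing to the orbit limit improves this to membership in a level.\<close>
    obtain x where x: "x \<in> topspace X" using assms(1) by blast
    obtain r where r: "r \<in> R" "g x \<in> \<beta> x r"
      using structured_pair[OF ls x strict_contraction_in[OF g x]] .
    obtain y where "y \<in> topspace X" "g y \<in> level y r"
      using strict_contraction_orbit_limit[OF rc g x r] .
    then have "P (y, r)" unfolding P_def using r by simp
    then show "\<exists>p. P p" ..
  next
    fix p and n :: nat assume "P p"
    then obtain x r where p: "p = (x, r)" "x \<in> topspace X" "r \<in> R" "g x \<in> level x r"
      unfolding P_def by (cases p) auto
    obtain y s where "y \<in> topspace X" "s \<in> R" "g y \<in> level y s" "level_less s r" "y \<in> level x r"
      using strict_contraction_descend[OF Haus ord rc ls g p(2-4) ne[OF p(2)]] .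
    then have "P (y, s) \<and> Q p (y, s)"
      unfolding P_def Q_def p(1) by simp
    then show "\<exists>q. P q \<and> Q p q" ..
  qed
  then obtain h where h: "\<And>n. P (h n)" "\<And>n. Q (h n) (h (Suc n))" by blast
  define a where "a n = fst (h n)" for n
  define \<rho> where "\<rho> n = snd (h n)" for n
  have a: "a n \<in> topspace X" and \<rho>: "\<rho> n \<in> R" and ga: "g (a n) \<in> level (a n) (\<rho> n)" for n
    using h(1)[of n] unfolding P_def a_def \<rho>_def by (auto split: prod.splits)
  have less: "level_less (\<rho> (Suc n)) (\<rho> n)" and anext: "a (Suc n) \<in> level (a n) (\<rho> n)" for n
    using h(2)[of n] unfolding Q_def a_def \<rho>_def by (auto split: prod.splits)
  have base: "\<exists>k. level_le (\<rho> k) s" if "s \<in> R" for s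
    using CDLB_base[where \<rho> = \<rho>, OF \<open>CDLB\<close> \<rho> less that] .
  have decr: "level x (\<rho> (k + d)) \<subseteq> level x (\<rho> k)" if "x \<in> topspace X" for x k d
  proof (induction d)
    case (Suc d)
    then show ?case
      using level_leD[OF level_less_level_le[OF less[of "k + d"]] that] by auto
  qed simp
  \<comment> \<open>Later levels are contained in the level of \<open>\<rho> k\<close>, so all links
    compose inside it by transitivity.\<close>
  have tail: "a (k + d) \<in> level (a k) (\<rho> k)" for k d
  proof (induction d)
    case 0
    then show ?case using center_in_level[OF a \<rho>] by simp
  next
    case (Suc d)
    then show ?case
      using level_trans[OF ord a \<rho> Suc] anext[of "k + d"] decr[OF a, of "k + d" k d] by auto
  qed
  have "\<forall>m\<ge>k. \<forall>n\<ge>k. a m \<in> \<beta> (a n) s" if "level_le (\<rho> k) s" for k s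
  proof (intro allI impI)
    fix m n assume "m \<ge> k" "n \<ge> k"
    then have "a m \<in> level (a k) (\<rho> k)" "a n \<in> level (a k) (\<rho> k)"
      using tail[of k "m - k"] tail[of k "n - k"] by auto
    then have "a m \<in> level (a n) (\<rho> k)"
      using level_trans[OF ord a \<rho>] level_sym[OF a] by blast
    then show "a m \<in> \<beta> (a n) s"
      using level_leD[OF that a] level_subset_beta by blast
  qed
  then have "beta_Cauchy a"
    unfolding beta_Cauchy_def using base by blast
  then obtain y where y: "y \<in> topspace X" "limitin X a y sequentially"
    using rc a unfolding radially_complete_def beta_complete_def by blast
  have "\<forall>\<^sub>F i in sequentially. g (a i) \<in> \<beta> (a i) s" if s: "s \<in> R" for s
  proof -
    obtain k where k: "level_le (\<rho> k) s" using base[OF s] by blast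
    have "g (a i) \<in> \<beta> (a i) s" if "i \<ge> k" for i
    proof -
      have "g (a i) \<in> level (a i) (\<rho> k)"
        using ga[of i] decr[OF a, of i k "i - k"] that by auto
      then show ?thesis
        using level_leD[OF k a] level_subset_beta by blast
    qed
    then show ?thesis unfolding eventually_sequentially by blast
  qed
  then have "g y = y"
    using strict_contraction_limit_fixed[OF Haus g a y] by blast
  then show False using ne y(1) by blast
qed

section \<open>Uniqueness of the fixed point\<close>

text \<open>Iterating \<open>g\<close> leaves both points in place while the radial value runs
  through a swing sequence.\<close>

lemma strict_contraction_fixed_level:
  assumes g: "strict_contraction g" and r: "r \<in> R" and x: "x \<in> topspace X" and y: "y \<in> topspace X"
    and "g x = x" "g y = y" and "y \<in> \<beta> x r"
  shows "y \<in> level x r"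
proof -
  obtain \<rho> where \<rho>: "swing_sequence r \<rho>"
    "\<And>x y k. x \<in> topspace X \<Longrightarrow> y \<in> \<beta> x r \<Longrightarrow> (g ^^ k) y \<in> \<beta> ((g ^^ k) x) (\<rho> k)"
    using strict_contraction_swing_sequence[OF g r] by metis
  have "(g ^^ k) z = z" if "g z = z" for z k
    using that by (induction k) auto
  then have "y \<in> \<beta> x (\<rho> k)" for k
    using \<rho>(2)[OF x] assms(5-7) by metis
  then show ?thesis
    unfolding level_def using y \<rho>(1) by blast
qed

lemma strict_contraction_fixed_unique:
  assumes Haus: "Hausdorff_space X" and ls: "level_structured" and "CDLB"
    and g: "strict_contraction g" and x: "x \<in> topspace X" and y: "y \<in> topspace X"
    and fix_x: "g x = x" and fix_y: "g y = y"
  shows "x = y"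
proof (rule ccontr)
  assume ne: "x \<noteq> y"
  \<comment> \<open>Here the points stay constant and only the radial value descends; each new ball
    membership becomes level membership by \<open>strict_contraction_fixed_level\<close>.\<close>
  have "\<exists>\<rho>. \<forall>n. (\<rho> n \<in> R \<and> y \<in> level x (\<rho> n)) \<and> level_less (\<rho> (Suc n)) (\<rho> n)"
  proof (rule dependent_nat_choice)
    show "\<exists>r. r \<in> R \<and> y \<in> level x r"
      using structured_pair[OF ls x y] strict_contraction_fixed_level[OF g _ x y fix_x fix_y] by metis
    show "\<exists>s. (s \<in> R \<and> y \<in> level x s) \<and> level_less s r" if "r \<in> R \<and> y \<in> level x r" for r and n :: nat
      using level_structured_descend[OF Haus ls x _ _ ne] that
        strict_contraction_fixed_level[OF g _ x y fix_x fix_y] by metis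
  qed
  then obtain \<rho> where \<rho>: "\<And>n. \<rho> n \<in> R" "\<And>n. y \<in> level x (\<rho> n)"
    "\<And>n. level_less (\<rho> (Suc n)) (\<rho> n)"
    by (elim exE) metis
  have "y \<in> \<beta> x s" if s: "s \<in> R" for s
  proof -
    obtain k where "level_le (\<rho> k) s"
      using CDLB_base[where \<rho> = \<rho>, OF \<open>CDLB\<close> \<rho>(1,3) s] by blast
    then show ?thesis
      using level_leD[OF _ x] \<rho>(2) level_subset_beta by blast
  qed
  then show False
    using Hausdorff_eqI[OF Haus x y] ne by blast
qed

end

theorem theorem3p31:
  fixes X :: "'a topology" and R :: "'r set" and \<beta> :: "'a \<Rightarrow> 'r \<Rightarrow> 'a set" and f :: "'a \<Rightarrow> 'a"
  assumes "beta_space X R \<beta>"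
    and "topspace X \<noteq> {}"
    and "Hausdorff_space X"
    and "beta_space.ordered X R \<beta>"
    and "beta_space.radially_complete X R \<beta>"
    and "beta_space.level_structured X R \<beta>"
    and "beta_space.CDLB X R \<beta>"
    and "beta_space.contraction X R \<beta> f"
  shows "\<exists>!x. x \<in> topspace X \<and> f x = x"
proof -
  interpret beta_space X R \<beta> by fact
  have f: "f \<in> topspace X \<rightarrow> topspace X"
    using assms(8) unfolding contraction_def by blast
  obtain N where N: "strict_contraction (f ^^ N)"
    using contraction_strict_funpow[OF assms(8)] .
  note unique = strict_contraction_fixed_unique[OF assms(3,6,7) N]
  obtain x where x: "x \<in> topspace X" "(f ^^ N) x = x"
    using strict_contraction_exists_fixed[OF assms(2-7) N] by blast
  \<comment> \<open>Since \<open>f\<close> commutes with its iterate, \<open>f x\<close> is also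
    fixed by \<open>f ^^ N\<close>, and uniqueness there forces \<open>f x = x\<close>.\<close>
  have "(f ^^ N) (f x) = f x"
    using x(2) by (metis funpow_swap1)
  then have "f x = x"
    using unique[of "f x" x] x f by blast
  moreover have "(f ^^ N) y = y" if "f y = y" for y
    using that by (induction N) auto
  ultimately show ?thesis
    using x unique by blast
qed

end
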